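(* Let $n\ge 1$, let $W=(w_{ij})_{n\times n}$ be a row-stochastic matrix, let $\beta\in(0,1)$ and let $\alpha>1$. Consider the best-response opinion dynamics $$x(k+1)=\beta x(k)+(1-\beta)\operatorname{BR}^\alpha(x(k);W),\qquad k\in\mathbb{N},$$ on the influence network $\mathcal{G}=\mathcal{G}(W)$. Then the solution $x(k)$ converges to a consensus equilibrium for any initial state $x(0)\in\mathbb{R}^n$ if and only if the graph $\mathcal{G}$ has a unique globally-reachable strongly connected component, i.e., the condensation digraph $\mathcal{C}(\mathcal{G})$ contains a unique (globally-reachable) sink.
   Context: A matrix $W=(w_{ij})_{n\times n}$ is row-stochastic if all its entries are nonnegative and each row sums to $1$. $\mathcal{G}(W)$ is the weighted directed graph on the node set $\{1,\dots,n\}$ with a link from $i$ to $j$ (of weight $w_{ij}$) if and only if $w_{ij}>0$. $\mathbb{N}=\{0,1,2,\dots\}$. Social cost: for $x\in\mathbb{R}^n$, $z\in\mathbb{R}$ and $i\in\{1,\dots,n\}$, $u_i(z;x)=\sum_{j=1}^n w_{ij}|z-x_j|^\alpha$. Best-response operator: for $\alpha>0$, $\operatorname{BR}^\alpha(x;W)\in\mathbb{R}^n$ (also written $\operatorname{BR}^\alpha(x,W)$) has $i$-th component $\operatorname{BR}^\alpha_i(x;W)$ determined by: (1) $\operatorname{BR}^\alpha_i(x;W)\in\arg\min_{z\in\mathbb{R}}u_i(z;x)$; (2) $|\operatorname{BR}^\alpha_i(x;W)-x_i|\le|z^*-x_i|$ for all $z^*\in\arg\min_{z\in\mathbb{R}}u_i(z;x)$;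 (3) if two distinct minimizers $z_1,z_2$ of $u_i(\cdot;x)$ both attain the minimal distance to $x_i$ among all minimizers, then $\operatorname{BR}^\alpha_i(x;W)=\min\{z_1,z_2\}$. (For $\alpha>1$ the minimizer is unique.) An equilibrium is a vector $x^*\in\mathbb{R}^n$ with $x^*=\beta x^*+(1-\beta)\operatorname{BR}^\alpha(x^*;W)$; a consensus equilibrium is an equilibrium of the form $c\mathbf{1}_n$ with $c\in\mathbb{R}$ ($\mathbf{1}_n$ the all-ones vector). Graph notions: a strongly connected component of a digraph $\mathcal{G}$ is a strongly connected subgraph $\mathcal{H}$ such that no subgraph strictly containing $\mathcal{H}$ is strongly connected. The condensation digraph $\mathcal{C}(\mathcal{G})$ has as nodes the strongly connected components of $\mathcal{G}$, with a directed edge from $\mathcal{H}_1$ to $\mathcal{H}_2$ (distinct components) if and only if $\mathcal{G}$ has a directed edge from a node of $\mathcal{H}_1$ to a node of $\mathcal{H}_2$. A sink is a node with out-degree $0$. A node (or component) is globally reachable if it can be reached by a directed path from every node. *)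

theory Defs
  imports "Graph_Theory.Digraph_Component" "HOL-Analysis.Analysis"
begin

definition row_stochastic :: "real^'n^'n \<Rightarrow> bool" where
  "row_stochastic W \<longleftrightarrow> (\<forall>i j. 0 \<le> W $ i $ j) \<and> (\<forall>i. (\<Sum>j\<in>UNIV. W $ i $ j) = 1)"

definition social_cost :: "real \<Rightarrow> real^'n^'n \<Rightarrow> real^'n \<Rightarrow> 'n \<Rightarrow> real \<Rightarrow> real" where
  "social_cost \<alpha> W x i z = (\<Sum>j\<in>UNIV. W $ i $ j * \<bar>z - x $ j\<bar> powr \<alpha>)"

definition cost_minimizers :: "real \<Rightarrow> real^'n^'n \<Rightarrow> real^'n \<Rightarrow> 'n \<Rightarrow> real set" where
  "cost_minimizers \<alpha> W x i = {z. is_arg_min (social_cost \<alpha> W x i) (\<lambda>_. True) z}"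

text \<open>The last conjunct breaks a tie between two minimizers equidistant from \<open>x $ i\<close>.\<close>

definition is_best_response :: "real \<Rightarrow> real^'n^'n \<Rightarrow> real^'n \<Rightarrow> 'n \<Rightarrow> real \<Rightarrow> bool" where
  "is_best_response \<alpha> W x i z \<longleftrightarrow>
     z \<in> cost_minimizers \<alpha> W x i \<and>
     (\<forall>z'\<in>cost_minimizers \<alpha> W x i. \<bar>z - x $ i\<bar> \<le> \<bar>z' - x $ i\<bar>) \<and>
     (\<forall>z1 z2. z1 \<noteq> z2 \<and>
        is_arg_min (\<lambda>z'. \<bar>z' - x $ i\<bar>) (\<lambda>z'. z' \<in> cost_minimizers \<alpha> W x i) z1 \<and>
        is_arg_min (\<lambda>z'. \<bar>z' - x $ i\<bar>) (\<lambda>z'. z' \<in> cost_minimizers \<alpha> W x i) z2 \<longrightarrow>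
        z = min z1 z2)"

text \<open>
  For row-stochastic \<open>W\<close> and \<open>\<alpha> > 0\<close> the set of minimizers is nonempty and compact, so exactly one
  value satisfies \<^const>\<open>is_best_response\<close> and the description below is proper.
\<close>

definition BR :: "real \<Rightarrow> real^'n^'n \<Rightarrow> real^'n \<Rightarrow> real^'n" where
  "BR \<alpha> W x = (\<chi> i. THE z. is_best_response \<alpha> W x i z)"

primrec opinions :: "real \<Rightarrow> real \<Rightarrow> real^'n^'n \<Rightarrow> real^'n \<Rightarrow> nat \<Rightarrow> real^'n" where
  "opinions \<alpha> \<beta> W x0 0 = x0"
| "opinions \<alpha> \<beta> W x0 (Suc k) =
     \<beta> *\<^sub>R opinions \<alpha> \<beta> W x0 k + (1 - \<beta>) *\<^sub>R BR \<alpha> W (opinions \<alpha> \<beta> W x0 k)"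

definition equilibrium :: "real \<Rightarrow> real \<Rightarrow> real^'n^'n \<Rightarrow> real^'n \<Rightarrow> bool" where
  "equilibrium \<alpha> \<beta> W x \<longleftrightarrow> x = \<beta> *\<^sub>R x + (1 - \<beta>) *\<^sub>R BR \<alpha> W x"

definition consensus_equilibrium :: "real \<Rightarrow> real \<Rightarrow> real^'n^'n \<Rightarrow> real^'n \<Rightarrow> bool" where
  "consensus_equilibrium \<alpha> \<beta> W x \<longleftrightarrow> equilibrium \<alpha> \<beta> W x \<and> (\<exists>c. x = c *\<^sub>R 1)"

text \<open>Self-loops are kept.  The link weights \<open>W $ i $ j\<close> are not stored in the digraph.\<close>

definition influence_digraph :: "real^'n^'n \<Rightarrow> ('n, 'n \<times> 'n) pre_digraph" where
  "influence_digraph W =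
     \<lparr>verts = UNIV, arcs = {(i, j). W $ i $ j > 0}, tail = fst, head = snd\<rparr>"

text \<open>
  Strongly connected components are the library's \<^const>\<open>pre_digraph.sccs\<close>; by
  \<open>pre_digraph.sccs_altdef2\<close> these are the maximal strongly connected subgraphs.
\<close>

definition condensation ::
  "('a, 'b) pre_digraph \<Rightarrow> (('a, 'b) pre_digraph, ('a, 'b) pre_digraph \<times> ('a, 'b) pre_digraph) pre_digraph" where
  "condensation G =
     \<lparr>verts = pre_digraph.sccs G,
      arcs = {(H1, H2). H1 \<in> pre_digraph.sccs G \<and> H2 \<in> pre_digraph.sccs G \<and> H1 \<noteq> H2 \<and>
                (\<exists>u\<in>verts H1. \<exists>v\<in>verts H2. u \<rightarrow>\<^bsub>G\<^esub> v)},
      tail = fst, head = snd\<rparr>"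

text \<open>
  \<^const>\<open>out_degree\<close> is a cardinality, so this is meaningful only for digraphs in which every
  vertex has finitely many outgoing arcs.
\<close>

definition sink :: "('a, 'b) pre_digraph \<Rightarrow> 'a \<Rightarrow> bool" where
  "sink G v \<longleftrightarrow> v \<in> verts G \<and> out_degree G v = 0"

definition globally_reachable :: "('a, 'b) pre_digraph \<Rightarrow> 'a \<Rightarrow> bool" where
  "globally_reachable G v \<longleftrightarrow> v \<in> verts G \<and> (\<forall>u\<in>verts G. u \<rightarrow>\<^sup>*\<^bsub>G\<^esub> v)"

definition globally_reachable_scc :: "('a, 'b) pre_digraph \<Rightarrow> ('a, 'b) pre_digraph \<Rightarrow> bool" where
  "globally_reachable_scc G H \<longleftrightarrow>
     H \<in> pre_digraph.sccs G \<and> (\<forall>u\<in>verts G. \<exists>v\<in>verts H. u \<rightarrow>\<^sup>*\<^bsub>G\<^esub> v)"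

end

theory Submission
  imports Defs
begin

text \<open>
  All three conditions are shown to be equivalent to the existence of a vertex \<open>r\<close> that every vertex
  of the influence digraph reaches.

  For \<open>\<alpha> > 1\<close> the social cost of an agent is differentiable, and its derivative is strictly increasing,
  so the best response is the unique root of the marginal cost. Although this root has no closed form,
  comparing marginal costs shows that the best response is monotone and commutes with translations,
  hence is nonexpansive, and that it lies strictly below the maximum of the neighbours' opinions
  unless they all hold this maximum (\<open>BR_le_add\<close>, \<open>BR_eq_upper_bound\<close>). It also commutes with negation,
  which turns statements about maxima into statements about minima.

  Suppose that all agents reach \<open>r\<close>. The spread of opinions, highest minus lowest, never
  increases. If it is the same after as many steps as the longest of the chosen paths to \<open>r\<close>, then
  tracing the agents at the extremes back in time along these paths shows that \<open>r\<close> started at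
  both extremes at once, so the spread is \<open>0\<close> (\<open>ex_spread_contraction_time\<close>). By compactness and
  continuity the spread then tends to \<open>0\<close> (\<open>spread_tendsto_zero\<close>), and since the highest opinion is
  nonincreasing and bounded below, all opinions converge to one value. Every consensus is an equilibrium.

  Conversely, if some two agents have no common descendant, their sets of descendants can be held at
  different constant opinions forever (\<open>common_descendant_if_consensus\<close>). And in a finite digraph in which
  any two vertices have a common descendant, every vertex of a sink component is globally reachable.

  The graph-theoretic equivalences rest on \<open>reaches_sink_component\<close>: every vertex of a finite digraph
  leads into a sink of the condensation.
\<close>

section \<open>The marginal cost\<close>

text \<open>
  Up to the factor \<open>\<alpha>\<close>, the function with \<open>p = \<alpha> - 1\<close> is the derivative of \<open>\<bar>t\<bar> powr \<alpha>\<close>.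
\<close>

definition signed_power :: "real \<Rightarrow> real \<Rightarrow> real" where
  "signed_power p t = sgn t * \<bar>t\<bar> powr p"

lemma signed_power_zero [simp]: "signed_power p 0 = 0"
  by (simp add: signed_power_def)

lemma signed_power_minus: "signed_power p (- t) = - signed_power p t"
  by (simp add: signed_power_def sgn_minus)

lemma signed_power_strict_mono:
  assumes "0 < p" "s < t"
  shows "signed_power p s < signed_power p t"
proof -
  consider "0 \<le> s" | "s < 0" "0 < t" | "t \<le> 0" using assms by linarith
  then show ?thesis
  proof cases
    case 1
    then show ?thesis using assms by (cases "s = 0") (auto simp: signed_power_def intro: powr_less_mono2)
  next
    case 2
    then have "signed_power p s < 0" "0 < signed_power p t"
      by (simp_all add: signed_power_def)
    then show ?thesis by simp
  next
    case 3
    then show ?thesis using assms by (cases "t = 0") (auto simp: signed_power_def intro: powr_less_mono2)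
  qed
qed

lemma signed_power_mono: "0 < p \<Longrightarrow> s \<le> t \<Longrightarrow> signed_power p s \<le> signed_power p t"
  using signed_power_strict_mono[of p s t] by (cases "s = t") auto

lemma continuous_on_signed_power [continuous_intros]:
  assumes "0 < p" "continuous_on A f"
  shows "continuous_on A (\<lambda>t. signed_power p (f t))"
proof -
  \<comment> \<open>The factor \<open>sgn t\<close> is discontinuous at \<open>0\<close>; this form of the function has only continuous parts.\<close>
  have "signed_power p t = (max t 0) powr p - (max (- t) 0) powr p" for t
    using assms(1) by (auto simp: signed_power_def sgn_if max_def)
  moreover have "continuous_on A (\<lambda>t. (max (f t) 0) powr p - (max (- f t) 0) powr p)"
    using assms
    by (intro continuous_on_diff continuous_on_powr' continuous_on_max continuous_on_minus
        continuous_on_const) auto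
  ultimately show ?thesis by simp
qed

lemma has_real_derivative_abs_powr:
  assumes "1 < \<alpha>"
  shows "((\<lambda>t. \<bar>t\<bar> powr \<alpha>) has_real_derivative \<alpha> * signed_power (\<alpha> - 1) t) (at t)"
proof -
  consider "0 < t" | "t < 0" | "t = 0" by linarith
  then show ?thesis
  proof cases
    case 1
    have "((\<lambda>t. t powr \<alpha>) has_real_derivative \<alpha> * signed_power (\<alpha> - 1) t) (at t)"
      using 1 by (auto intro!: derivative_eq_intros simp: signed_power_def)
    then show ?thesis
      by (rule has_field_derivative_transform_within_open[of _ _ _ "{0<..}"]) (use 1 in auto)
  next
    case 2
    have "((\<lambda>t. (- t) powr \<alpha>) has_real_derivative \<alpha> * signed_power (\<alpha> - 1) t) (at t)"
      using 2 by (auto intro!: derivative_eq_intros simp: signed_power_def)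
    then show ?thesis
      by (rule has_field_derivative_transform_within_open[of _ _ _ "{..<0}"]) (use 2 in auto)
  next
    case 3
    \<comment> \<open>At the kink of the absolute value the difference quotient is itself a signed power, of positive
      exponent because \<open>\<alpha> > 1\<close>, and so it tends to \<open>0\<close>.\<close>
    have "isCont (signed_power (\<alpha> - 1)) 0"
      using continuous_on_signed_power[of "\<alpha> - 1" UNIV "\<lambda>t. t"] assms
      by (simp add: continuous_on_eq_continuous_at)
    then have "(signed_power (\<alpha> - 1) \<longlongrightarrow> 0) (at 0)"
      by (simp add: isCont_def)
    moreover have "\<bar>h\<bar> powr \<alpha> / h = signed_power (\<alpha> - 1) h" if "h \<noteq> 0" for h
    proof -
      have "\<bar>h\<bar> powr \<alpha> = \<bar>h\<bar> powr (\<alpha> - 1) * \<bar>h\<bar>"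
        using that by (simp add: powr_diff)
      then show ?thesis using that by (simp add: signed_power_def sgn_if abs_if)
    qed
    then have "\<forall>\<^sub>F h in at 0. signed_power (\<alpha> - 1) h = \<bar>h\<bar> powr \<alpha> / h"
      by (auto simp: eventually_at_filter)
    ultimately have "((\<lambda>h. \<bar>h\<bar> powr \<alpha> / h) \<longlongrightarrow> 0) (at 0)"
      by (rule Lim_transform_eventually)
    then show ?thesis using 3 assms by (simp add: DERIV_def)
  qed
qed

definition marginal_cost :: "real \<Rightarrow> real^'n^'n \<Rightarrow> real^'n \<Rightarrow> 'n \<Rightarrow> real \<Rightarrow> real" where
  "marginal_cost \<alpha> W x i z = (\<Sum>j\<in>UNIV. W $ i $ j * signed_power (\<alpha> - 1) (z - x $ j))"

locale best_response =
  fixes W :: "real^'n^'n" and \<alpha> :: real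
  assumes stochastic: "row_stochastic W" and exponent: "1 < \<alpha>"
begin

lemma weight_nonneg: "0 \<le> W $ i $ j"
  using stochastic by (simp add: row_stochastic_def)

lemma row_sum: "(\<Sum>j\<in>UNIV. W $ i $ j) = 1"
  using stochastic by (simp add: row_stochastic_def)

lemma ex_neighbour: "\<exists>j. 0 < W $ i $ j"
proof (rule ccontr)
  assume "\<not> ?thesis"
  then have "W $ i $ j = 0" for j using weight_nonneg[of i j] by (metis less_eq_real_def)
  then show False using row_sum[of i] by simp
qed

lemma social_cost_derivative:
  "(social_cost \<alpha> W x i has_real_derivative \<alpha> * marginal_cost \<alpha> W x i z) (at z)"
proof -
  have "((\<lambda>z. \<Sum>j\<in>UNIV. W $ i $ j * \<bar>z - x $ j\<bar> powr \<alpha>) has_real_derivative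
      (\<Sum>j\<in>UNIV. W $ i $ j * (\<alpha> * signed_power (\<alpha> - 1) (z - x $ j) * 1))) (at z)"
    by (intro DERIV_sum DERIV_cmult DERIV_chain'[OF _ has_real_derivative_abs_powr[OF exponent]])
      (auto intro!: derivative_eq_intros)
  then show ?thesis
    unfolding social_cost_def[abs_def] marginal_cost_def
    by (simp add: sum_distrib_left mult_ac)
qed

lemma weighted_marginal_le:
  assumes "0 < W $ i $ j \<Longrightarrow> s \<le> t"
  shows "W $ i $ j * signed_power (\<alpha> - 1) s \<le> W $ i $ j * signed_power (\<alpha> - 1) t"
proof (cases "W $ i $ j = 0")
  case False
  then have "s \<le> t" using assms weight_nonneg[of i j] by simp
  then show ?thesis
    using exponent weight_nonneg by (intro mult_left_mono signed_power_mono) simp_all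
qed simp

text \<open>
  The marginal cost depends only on the differences \<open>z - x $ j\<close> for the out-neighbours \<open>j\<close>, and
  monotonically. Every comparison of best responses below is an instance of this lemma or of
  its strict version.
\<close>

lemma marginal_cost_le:
  assumes "\<And>j. 0 < W $ i $ j \<Longrightarrow> z - x $ j \<le> z' - y $ j"
  shows "marginal_cost \<alpha> W x i z \<le> marginal_cost \<alpha> W y i z'"
  unfolding marginal_cost_def by (intro sum_mono weighted_marginal_le assms)

lemma marginal_cost_less:
  assumes "\<And>j. 0 < W $ i $ j \<Longrightarrow> z - x $ j \<le> z' - y $ j"
    and "0 < W $ i $ k" "z - x $ k < z' - y $ k"
  shows "marginal_cost \<alpha> W x i z < marginal_cost \<alpha> W y i z'"
  unfolding marginal_cost_def
proof (rule sum_strict_mono_ex1)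
  show "\<forall>j\<in>UNIV. W $ i $ j * signed_power (\<alpha> - 1) (z - x $ j)
      \<le> W $ i $ j * signed_power (\<alpha> - 1) (z' - y $ j)"
    by (intro ballI weighted_marginal_le assms(1))
  have "W $ i $ k * signed_power (\<alpha> - 1) (z - x $ k)
      < W $ i $ k * signed_power (\<alpha> - 1) (z' - y $ k)"
    using assms(2,3) exponent by (intro mult_strict_left_mono signed_power_strict_mono) simp_all
  then show "\<exists>j\<in>UNIV. W $ i $ j * signed_power (\<alpha> - 1) (z - x $ j)
      < W $ i $ j * signed_power (\<alpha> - 1) (z' - y $ j)" by blast
qed simp

lemma marginal_cost_strict_mono:
  "z < z' \<Longrightarrow> marginal_cost \<alpha> W x i z < marginal_cost \<alpha> W x i z'"
  using ex_neighbour[of i] by (auto intro: marginal_cost_less)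

lemma ex_marginal_cost_zero: "\<exists>z. marginal_cost \<alpha> W x i z = 0"
proof -
  \<comment> \<open>All opinions lie in \<open>[- b, b]\<close>, so the marginal cost changes sign on this interval.\<close>
  define b where "b = norm x"
  have bound: "\<bar>x $ j\<bar> \<le> b" for j by (simp add: b_def component_le_norm_cart)
  have zero: "marginal_cost \<alpha> W 0 i 0 = 0" by (simp add: marginal_cost_def)
  have "marginal_cost \<alpha> W x i (- b) \<le> marginal_cost \<alpha> W 0 i 0"
    using bound by (intro marginal_cost_le) (simp, smt (verit))
  moreover have "marginal_cost \<alpha> W 0 i 0 \<le> marginal_cost \<alpha> W x i b"
    using bound by (intro marginal_cost_le) (simp, smt (verit))
  moreover have "continuous_on {- b..b} (marginal_cost \<alpha> W x i)"
    unfolding marginal_cost_def[abs_def] using exponent by (intro continuous_intros) auto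
  moreover have "- b \<le> b" by (simp add: b_def)
  ultimately show ?thesis using IVT'[of "marginal_cost \<alpha> W x i" "- b" 0 b] zero by auto
qed

text \<open>
  The marginal cost is strictly increasing, so it is negative before its root and positive after it;
  by the mean value theorem every other point is strictly more expensive than the root.
\<close>

lemma social_cost_strict_minimum:
  assumes root: "marginal_cost \<alpha> W x i z = 0" and "z' \<noteq> z"
  shows "social_cost \<alpha> W x i z < social_cost \<alpha> W x i z'"
proof -
  note deriv = social_cost_derivative
  consider "z < z'" | "z' < z" using assms(2) by linarith
  then show ?thesis
  proof cases
    case 1
    then obtain \<xi> where \<xi>: "z < \<xi>" "\<xi> < z'"
      "social_cost \<alpha> W x i z' - social_cost \<alpha> W x i z = (z' - z) * (\<alpha> * marginal_cost \<alpha> W x i \<xi>)"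
      using MVT2[OF 1 deriv] by blast
    have "0 < marginal_cost \<alpha> W x i \<xi>" using marginal_cost_strict_mono[OF \<xi>(1), of x i] root by simp
    then have "0 < (z' - z) * (\<alpha> * marginal_cost \<alpha> W x i \<xi>)" using 1 exponent by simp
    then show ?thesis using \<xi> by linarith
  next
    case 2
    then obtain \<xi> where \<xi>: "z' < \<xi>" "\<xi> < z"
      "social_cost \<alpha> W x i z - social_cost \<alpha> W x i z' = (z - z') * (\<alpha> * marginal_cost \<alpha> W x i \<xi>)"
      using MVT2[OF 2 deriv] by blast
    have "marginal_cost \<alpha> W x i \<xi> < 0" using marginal_cost_strict_mono[OF \<xi>(2), of x i] root by simp
    then have "(z - z') * (\<alpha> * marginal_cost \<alpha> W x i \<xi>) < 0"
      using 2 exponent by (simp add: mult_less_0_iff)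
    then show ?thesis using \<xi> by linarith
  qed
qed

section \<open>The best-response operator\<close>

text \<open>
  The root is the only minimizer, so the tie-breaking clauses of \<^const>\<open>is_best_response\<close> are
  trivially met.
\<close>

lemma BR_eqI:
  assumes "marginal_cost \<alpha> W x i z = 0"
  shows "BR \<alpha> W x $ i = z"
proof -
  have "cost_minimizers \<alpha> W x i = {z}"
    using social_cost_strict_minimum[OF assms]
    by (force simp: cost_minimizers_def is_arg_min_def)
  then have "is_best_response \<alpha> W x i z' \<longleftrightarrow> z' = z" for z'
    by (auto simp: is_best_response_def is_arg_min_def)
  then have "is_best_response \<alpha> W x i = (\<lambda>z'. z' = z)" by blast
  then show ?thesis by (simp add: BR_def)
qed

lemma BR_root: "marginal_cost \<alpha> W x i (BR \<alpha> W x $ i) = 0"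
  using ex_marginal_cost_zero[of x i] BR_eqI by metis

lemma BR_const:
  assumes "\<And>j. 0 < W $ i $ j \<Longrightarrow> x $ j = c"
  shows "BR \<alpha> W x $ i = c"
proof (rule BR_eqI)
  have "W $ i $ j * signed_power (\<alpha> - 1) (c - x $ j) = 0" for j
    using assms[of j] weight_nonneg[of i j] by (cases "W $ i $ j = 0") auto
  then show "marginal_cost \<alpha> W x i c = 0" unfolding marginal_cost_def by (intro sum.neutral) blast
qed

lemma BR_minus: "BR \<alpha> W (- x) = - BR \<alpha> W x"
proof -
  have "marginal_cost \<alpha> W (- x) i (- z) = - marginal_cost \<alpha> W x i z" for i z
    using signed_power_minus[of "\<alpha> - 1" "z - x $ j" for j]
    by (simp add: marginal_cost_def sum_negf)
  then have "marginal_cost \<alpha> W (- x) i (- (BR \<alpha> W x $ i)) = 0" for i by (simp add: BR_root)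
  then show ?thesis by (simp add: vec_eq_iff BR_eqI)
qed

text \<open>
  Monotonicity of the best response together with its equivariance under translations: shifting all
  neighbours by \<open>d\<close> shifts the root of the marginal cost by \<open>d\<close>. The upper bound
  \<open>BR_le\<close> and nonexpansiveness are special cases.
\<close>

lemma BR_le_add:
  assumes "\<And>j. 0 < W $ i $ j \<Longrightarrow> x $ j \<le> y $ j + d"
  shows "BR \<alpha> W x $ i \<le> BR \<alpha> W y $ i + d"
proof (rule ccontr)
  let ?z = "BR \<alpha> W y $ i + d"
  assume "\<not> ?thesis"
  then have "marginal_cost \<alpha> W x i ?z < 0"
    using marginal_cost_strict_mono[of ?z "BR \<alpha> W x $ i" x i] by (simp add: BR_root)
  moreover have "marginal_cost \<alpha> W y i (BR \<alpha> W y $ i) \<le> marginal_cost \<alpha> W x i ?z"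
    using assms by (intro marginal_cost_le) fastforce
  ultimately show False by (simp add: BR_root)
qed

lemma BR_le:
  assumes "\<And>j. 0 < W $ i $ j \<Longrightarrow> x $ j \<le> M"
  shows "BR \<alpha> W x $ i \<le> M"
  using BR_le_add[of i x 0 M] BR_const[of i 0 0] assms by simp

text \<open>
  Here \<open>\<alpha> > 1\<close> is essential: a neighbour strictly below \<open>M\<close> pulls the best response strictly below
  \<open>M\<close>, however small its weight. For \<open>\<alpha> = 1\<close> the best response is a weighted median, which ignores
  minorities.
\<close>

lemma BR_eq_upper_bound:
  assumes le: "\<And>j. 0 < W $ i $ j \<Longrightarrow> x $ j \<le> M" and eq: "BR \<alpha> W x $ i = M" and k: "0 < W $ i $ k"
  shows "x $ k = M"
proof (rule ccontr)
  assume "x $ k \<noteq> M"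
  then have "x $ k < M" using le[OF k] by simp
  then have "marginal_cost \<alpha> W 0 i 0 < marginal_cost \<alpha> W x i M"
    using le k by (intro marginal_cost_less[of i _ _ _ _ k]) auto
  then show False using BR_root[of x i] eq by (simp add: marginal_cost_def)
qed

lemma BR_nonexpansive: "\<bar>BR \<alpha> W x $ i - BR \<alpha> W y $ i\<bar> \<le> norm (x - y)"
proof -
  have "\<bar>x $ j - y $ j\<bar> \<le> norm (x - y)" for j
    using component_le_norm_cart[of "x - y" j] by simp
  then have "x $ j \<le> y $ j + norm (x - y)" "y $ j \<le> x $ j + norm (x - y)" for j
    by (smt (verit))+
  then show ?thesis
    using BR_le_add[of i x y "norm (x - y)"] BR_le_add[of i y x "norm (x - y)"] by fastforce
qed

end

section \<open>Spread of an opinion vector\<close>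

definition highest :: "real^'n \<Rightarrow> real" where
  "highest x = Max (range (($) x))"

text \<open>
  The lowest opinion in \<open>x\<close> is \<open>- highest (- x)\<close>, so this is the highest minus the lowest opinion.
  Writing the minimum through \<^const>\<open>highest\<close> lets the odd symmetry of the dynamics transfer each
  fact about maxima to minima.
\<close>

definition spread :: "real^'n \<Rightarrow> real" where
  "spread x = highest x + highest (- x)"

lemma component_le_highest: "x $ i \<le> highest x"
  by (simp add: highest_def)

lemma ex_component_eq_highest: "\<exists>i. x $ i = highest x"
proof -
  have "highest x \<in> range (($) x)" unfolding highest_def by (rule Max_in) auto
  then show ?thesis by auto
qed

lemma highest_leI: "(\<And>i. x $ i \<le> M) \<Longrightarrow> highest x \<le> M"
  by (metis ex_component_eq_highest[of x])

lemma highest_nonexpansive: "\<bar>highest x - highest y\<bar> \<le> norm (x - y)"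
proof -
  have le: "highest x \<le> highest y + norm (x - y)" for x y :: "real^'n"
  proof (rule highest_leI)
    fix i
    show "x $ i \<le> highest y + norm (x - y)"
      using component_le_norm_cart[of "x - y" i] component_le_highest[of y i] by simp
  qed
  show ?thesis using le[of x y] le[of y x] by (simp add: norm_minus_commute abs_le_iff)
qed

lemma continuous_on_nonexpansive:
  fixes f :: "'a::real_normed_vector \<Rightarrow> real"
  assumes "\<And>x y. \<bar>f x - f y\<bar> \<le> norm (x - y)"
  shows "continuous_on A f"
  unfolding continuous_on_iff
proof (intro ballI allI impI)
  fix x and e :: real
  assume "0 < e"
  then show "\<exists>d>0. \<forall>x'\<in>A. dist x' x < d \<longrightarrow> dist (f x') (f x) < e"
    using assms by (intro exI[of _ e]) (auto simp: dist_norm intro: le_less_trans)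
qed

lemma continuous_highest: "continuous_on UNIV (highest :: real^'n \<Rightarrow> real)"
  by (rule continuous_on_nonexpansive) (rule highest_nonexpansive)

lemma continuous_spread: "continuous_on UNIV (spread :: real^'n \<Rightarrow> real)"
proof -
  have "continuous_on UNIV (\<lambda>x :: real^'n. highest (- x))"
    by (rule continuous_on_compose2[OF continuous_highest]) (intro continuous_on_minus continuous_on_id, simp)
  then show ?thesis
    unfolding spread_def[abs_def] by (intro continuous_on_add continuous_highest)
qed

lemma lowest_le_component: "- highest (- x) \<le> x $ i"
  using component_le_highest[of "- x" i] by simp

lemma spread_nonneg: "0 \<le> spread x"
  using component_le_highest[of x undefined] lowest_le_component[of x undefined]
  by (simp add: spread_def)

section \<open>The opinion dynamics\<close>

locale best_response_dynamics = best_response W \<alpha> for W :: "real^'n^'n" and \<alpha> :: real +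
  fixes \<beta> :: real
  assumes inertia: "0 < \<beta>" "\<beta> < 1"
begin

definition step :: "real^'n \<Rightarrow> real^'n" where
  "step x = \<beta> *\<^sub>R x + (1 - \<beta>) *\<^sub>R BR \<alpha> W x"

lemma step_component: "step x $ i = \<beta> * x $ i + (1 - \<beta>) * BR \<alpha> W x $ i"
  by (simp add: step_def)

lemma opinions_eq_funpow: "opinions \<alpha> \<beta> W x k = (step ^^ k) x"
  by (induction k) (simp_all add: step_def)

lemma step_minus: "step (- x) = - step x"
  by (simp add: step_def BR_minus)

lemma funpow_step_minus: "(step ^^ k) (- x) = - (step ^^ k) x"
  by (induction k) (simp_all add: step_minus)

lemma continuous_step: "continuous_on UNIV step"
proof -
  have "continuous_on UNIV (\<lambda>x. BR \<alpha> W x $ i)" for i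
    by (rule continuous_on_nonexpansive) (rule BR_nonexpansive)
  then have "continuous_on UNIV (BR \<alpha> W)"
    using continuous_on_vec_lambda[of UNIV "\<lambda>i x. BR \<alpha> W x $ i"] by simp
  then show ?thesis unfolding step_def[abs_def] by (intro continuous_intros)
qed

lemma continuous_funpow_step: "continuous_on UNIV (step ^^ k)"
proof (induction k)
  case (Suc k)
  have "continuous_on UNIV (\<lambda>x. step ((step ^^ k) x))"
    by (rule continuous_on_compose2[OF continuous_step Suc]) simp
  then show ?case by (simp add: o_def)
qed (simp add: id_def)

lemma highest_step_le: "highest (step x) \<le> highest x"
proof (rule highest_leI)
  fix i
  have "\<beta> * x $ i + (1 - \<beta>) * BR \<alpha> W x $ i \<le> highest x"
    using inertia component_le_highest[of x] BR_le[of i x "highest x"]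
    by (intro convex_bound_le) auto
  then show "step x $ i \<le> highest x" by (simp add: step_component)
qed

lemma highest_funpow_step_le: "highest ((step ^^ k) x) \<le> highest x"
proof (induction k)
  case (Suc k)
  then show ?case using highest_step_le[of "(step ^^ k) x"] by simp
qed simp

text \<open>
  An agent at the upper bound after a step was there before it, since it keeps a positive share
  \<open>\<beta>\<close> of its old opinion, and so were all its out-neighbours, since its best response
  is at the bound too.
\<close>

lemma step_eq_highest:
  assumes le: "\<And>j. x $ j \<le> M" and eq: "step x $ i = M"
  shows "x $ i = M" and "0 < W $ i $ j \<Longrightarrow> x $ j = M"
proof -
  have br: "BR \<alpha> W x $ i \<le> M" using le BR_le by blast
  have "\<beta> * (M - x $ i) + (1 - \<beta>) * (M - BR \<alpha> W x $ i) = 0"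
    using eq by (simp add: step_component algebra_simps)
  moreover have "0 \<le> \<beta> * (M - x $ i)" "0 \<le> (1 - \<beta>) * (M - BR \<alpha> W x $ i)"
    using le[of i] br inertia by simp_all
  ultimately have "\<beta> * (M - x $ i) = 0" "(1 - \<beta>) * (M - BR \<alpha> W x $ i) = 0" by linarith+
  then have "x $ i = M" "BR \<alpha> W x $ i = M" using inertia by simp_all
  then show "x $ i = M" and "0 < W $ i $ j \<Longrightarrow> x $ j = M"
    using BR_eq_upper_bound le by blast+
qed

text \<open>
  Going back one step in time, whoever holds the initial maximum had out-neighbours that all held it,
  so \<open>k\<close> steps back cover all paths of length \<open>k\<close>. Paths shorter than \<open>k\<close> are covered
  because an agent at the maximum was there at all earlier times.
\<close>

lemma funpow_step_eq_highest:
  assumes "(i, j) \<in> {(i, j). 0 < W $ i $ j} ^^ m" "m \<le> k"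
    and "(step ^^ k) x $ i = highest x"
  shows "x $ j = highest x"
  using assms
proof (induction k arbitrary: i m)
  case (Suc k)
  have le: "(step ^^ k) x $ l \<le> highest x" for l
    using component_le_highest highest_funpow_step_le order_trans by blast
  have eq: "step ((step ^^ k) x) $ i = highest x" using Suc.prems(3) by simp
  show ?case
  proof (cases m)
    case 0
    then show ?thesis using Suc.IH[of i 0] Suc.prems(1) step_eq_highest(1)[OF le eq] by simp
  next
    case (Suc m')
    then obtain l where "0 < W $ i $ l" "(l, j) \<in> {(i, j). 0 < W $ i $ j} ^^ m'"
      using relpow_Suc_E2[of i j m'] Suc.prems(1) by blast
    then show ?thesis
      using Suc.IH[of l m'] Suc Suc.prems(2) step_eq_highest(2)[OF le eq] by simp
  qed
qed simp

text \<open>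
  After \<open>K\<close> steps, where every agent has a path of length at most \<open>K\<close> to \<open>r\<close>, an unchanged spread
  means that both the maximum and the minimum are unchanged. Then some agent still holds each of them, and
  \<open>r\<close> must have held both at the start.
\<close>

lemma ex_spread_contraction_time:
  assumes "\<And>i. (i, r) \<in> {(i, j). 0 < W $ i $ j}\<^sup>*"
  shows "\<exists>K. \<forall>x. spread ((step ^^ K) x) = spread x \<longrightarrow> spread x = 0"
proof -
  have "\<exists>m. (i, r) \<in> {(i, j). 0 < W $ i $ j} ^^ m" for i
    using assms[of i] by (simp add: rtrancl_power)
  then obtain m where m: "\<And>i. (i, r) \<in> {(i, j). 0 < W $ i $ j} ^^ m i" by metis
  define K where "K = Max (range m)"
  have K: "m i \<le> K" for i by (simp add: K_def)
  have at_root: "x $ r = highest x" if top: "highest ((step ^^ K) x) = highest x" for x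
  proof -
    obtain i where "(step ^^ K) x $ i = highest x"
      using ex_component_eq_highest[of "(step ^^ K) x"] unfolding top by blast
    then show ?thesis by (rule funpow_step_eq_highest[OF m K])
  qed
  have "spread x = 0" if "spread ((step ^^ K) x) = spread x" for x
  proof -
    have "highest ((step ^^ K) x) = highest x" "highest ((step ^^ K) (- x)) = highest (- x)"
      using that highest_funpow_step_le[of K x] highest_funpow_step_le[of K "- x"]
      by (simp_all add: spread_def funpow_step_minus)
    then have "x $ r = highest x" "(- x) $ r = highest (- x)" using at_root by blast+
    then show ?thesis by (simp add: spread_def)
  qed
  then show ?thesis by blast
qed

lemma consensus_equilibrium_iff: "consensus_equilibrium \<alpha> \<beta> W x \<longleftrightarrow> (\<exists>c. x = c *\<^sub>R 1)"
proof -
  have "BR \<alpha> W (c *\<^sub>R 1) = c *\<^sub>R 1" for c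
    by (simp add: vec_eq_iff BR_const)
  then have "equilibrium \<alpha> \<beta> W (c *\<^sub>R 1)" for c
    by (simp add: equilibrium_def vec_eq_iff algebra_simps)
  then show ?thesis by (auto simp: consensus_equilibrium_def)
qed

lemma decseq_highest: "decseq (\<lambda>k. highest ((step ^^ k) x))"
  by (rule decseq_SucI) (simp add: highest_step_le)

lemma funpow_step_bounded: "\<bar>(step ^^ k) x $ i\<bar> \<le> \<bar>highest x\<bar> + \<bar>highest (- x)\<bar>"
  using component_le_highest[of "(step ^^ k) x" i] highest_funpow_step_le[of k x]
    lowest_le_component[of "(step ^^ k) x" i] highest_funpow_step_le[of k "- x"]
  by (simp add: funpow_step_minus)

text \<open>
  LaSalle's invariance argument. The spread decreases to a limit \<open>L\<close>, and by continuity it equals \<open>L\<close>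
  along the whole trajectory of any limit point \<open>y\<close>. So the spread of \<open>y\<close> does not contract, which
  forces \<open>L = 0\<close>.
\<close>

lemma spread_tendsto_zero:
  assumes "\<And>i. (i, r) \<in> {(i, j). 0 < W $ i $ j}\<^sup>*"
  shows "(\<lambda>k. spread ((step ^^ k) x)) \<longlonglongrightarrow> 0"
proof -
  obtain K where K: "\<And>x. spread ((step ^^ K) x) = spread x \<Longrightarrow> spread x = 0"
    using ex_spread_contraction_time[OF assms] by blast
  have dec: "decseq (\<lambda>k. spread ((step ^^ k) x))"
    using highest_step_le[of "(step ^^ k) x" for k] highest_step_le[of "- (step ^^ k) x" for k]
    by (intro decseq_SucI) (auto simp: spread_def step_minus intro: add_mono)
  obtain L where L: "(\<lambda>k. spread ((step ^^ k) x)) \<longlonglongrightarrow> L"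
    using decseq_convergent[OF dec, of 0] spread_nonneg by blast
  have "bounded (range (\<lambda>k. (step ^^ k) x))"
  proof (rule boundedI)
    fix y assume "y \<in> range (\<lambda>k. (step ^^ k) x)"
    then obtain k where "y = (step ^^ k) x" by blast
    then show "norm y \<le> (\<Sum>i\<in>(UNIV::'n set). \<bar>highest x\<bar> + \<bar>highest (- x)\<bar>)"
      by (intro order_trans[OF norm_le_l1_cart] sum_mono) (simp add: funpow_step_bounded)
  qed
  then obtain y s where s: "strict_mono s" and y: "((\<lambda>k. (step ^^ k) x) \<circ> s) \<longlonglongrightarrow> y"
    using bounded_imp_convergent_subsequence by blast
  have "(\<lambda>n. (step ^^ m) ((step ^^ s n) x)) \<longlonglongrightarrow> (step ^^ m) y" for m
    using y continuous_funpow_step[of m] by (auto intro: continuous_on_tendsto_compose simp: o_def)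
  then have "(\<lambda>n. spread ((step ^^ m) ((step ^^ s n) x))) \<longlonglongrightarrow> spread ((step ^^ m) y)" for m
    using continuous_spread by (auto intro: continuous_on_tendsto_compose)
  moreover have "(\<lambda>n. spread ((step ^^ m) ((step ^^ s n) x))) \<longlonglongrightarrow> L" for m
  proof -
    have "filterlim (\<lambda>n. s n + m) sequentially sequentially"
      using filterlim_subseq[OF s] filterlim_compose[OF filterlim_add_const_nat_at_top] by blast
    from filterlim_compose[OF L this] show ?thesis
      by (simp add: funpow_add add.commute)
  qed
  ultimately have "spread ((step ^^ m) y) = L" for m using LIMSEQ_unique by blast
  from this[of K] this[of 0] have "L = 0" using K[of y] by simp
  then show ?thesis using L by simp
qed

lemma converges_to_consensus:
  assumes "\<And>i. (i, r) \<in> {(i, j). 0 < W $ i $ j}\<^sup>*"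
  shows "\<exists>c. (\<lambda>k. (step ^^ k) x) \<longlonglongrightarrow> c *\<^sub>R 1"
proof -
  have "- \<bar>highest x\<bar> - \<bar>highest (- x)\<bar> \<le> highest ((step ^^ k) x)" for k
    using component_le_highest[of "(step ^^ k) x" undefined] funpow_step_bounded[of k x undefined]
    by linarith
  then obtain c where c: "(\<lambda>k. highest ((step ^^ k) x)) \<longlonglongrightarrow> c"
    using decseq_convergent[OF decseq_highest] by blast
  \<comment> \<open>This difference is the lowest opinion, so all opinions are squeezed towards \<open>c\<close>.\<close>
  have "(\<lambda>k. highest ((step ^^ k) x) - spread ((step ^^ k) x)) \<longlonglongrightarrow> c - 0"
    by (rule tendsto_diff[OF c spread_tendsto_zero[OF assms]])
  then have low: "(\<lambda>k. - highest (- (step ^^ k) x)) \<longlonglongrightarrow> c"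
    by (simp add: spread_def)
  have "(\<lambda>k. (step ^^ k) x $ i) \<longlonglongrightarrow> c" for i
    by (rule tendsto_sandwich[OF _ _ low c])
      (auto simp: component_le_highest lowest_le_component)
  then have "(\<lambda>k. (step ^^ k) x) \<longlonglongrightarrow> c *\<^sub>R 1" by (intro vec_tendstoI) simp
  then show ?thesis by blast
qed

text \<open>
  Agents respond only to their out-neighbours, so a set that no link leaves evolves independently of
  the rest, and agreement within it persists.
\<close>

lemma funpow_step_const_on_closed:
  assumes closed: "\<And>i j. i \<in> S \<Longrightarrow> 0 < W $ i $ j \<Longrightarrow> j \<in> S"
    and const: "\<And>i. i \<in> S \<Longrightarrow> x $ i = c" and "i \<in> S"
  shows "(step ^^ k) x $ i = c"
  using \<open>i \<in> S\<close>
proof (induction k arbitrary: i)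
  case (Suc k)
  then have "BR \<alpha> W ((step ^^ k) x) $ i = c" using closed by (intro BR_const) blast
  then show ?case using Suc by (simp add: step_component algebra_simps)
qed (simp add: const)

text \<open>
  If the descendants of \<open>u\<close> and those of \<open>v\<close> were disjoint, both sets would be closed under
  influence, and starting the first at \<open>1\<close> and the second at \<open>0\<close> would keep \<open>u\<close> and \<open>v\<close> apart
  forever.
\<close>

lemma common_descendant_if_consensus:
  assumes conv: "\<And>x. \<exists>c. (\<lambda>k. (step ^^ k) x) \<longlonglongrightarrow> c *\<^sub>R 1"
  shows "\<exists>w. (u, w) \<in> {(i, j). 0 < W $ i $ j}\<^sup>* \<and> (v, w) \<in> {(i, j). 0 < W $ i $ j}\<^sup>*"
proof (rule ccontr)
  define D where "D = (\<lambda>u. {w. (u, w) \<in> {(i, j). 0 < W $ i $ j}\<^sup>*})"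
  assume "\<not> ?thesis"
  then have disjoint: "w \<notin> D u" if "w \<in> D v" for w using that by (auto simp: D_def)
  have closed: "j \<in> D w" if "i \<in> D w" "0 < W $ i $ j" for w i j
    using that by (auto simp: D_def intro: rtrancl_into_rtrancl)
  define x :: "real^'n" where "x = (\<chi> i. if i \<in> D u then 1 else 0)"
  have u: "(step ^^ k) x $ u = 1" for k
    by (rule funpow_step_const_on_closed[of "D u"]) (auto intro: closed simp: x_def, simp add: D_def)
  have v: "(step ^^ k) x $ v = 0" for k
    by (rule funpow_step_const_on_closed[of "D v"])
      (auto intro: closed simp: x_def disjoint, simp add: D_def)
  obtain c where "(\<lambda>k. (step ^^ k) x) \<longlonglongrightarrow> c *\<^sub>R 1" using conv by blast
  then have "(\<lambda>k. (step ^^ k) x $ w) \<longlonglongrightarrow> c" for w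
    using tendsto_vec_nth[of "\<lambda>k. (step ^^ k) x" "c *\<^sub>R 1" _ w] by simp
  from this[of u] this[of v] have "c = 1" "c = 0" by (simp_all add: u v LIMSEQ_const_iff)
  then show False by simp
qed

end


section \<open>Sinks of the condensation\<close>

context wf_digraph begin

lemma scc_nonempty: "H \<in> sccs \<Longrightarrow> verts H \<noteq> {}"
  by (auto simp: sccs_def strongly_connected_def)

lemma scc_verts_subset: "H \<in> sccs \<Longrightarrow> verts H \<subseteq> verts G"
  using sccs_verts_subsets sccs_verts_conv by blast

lemma scc_reachable:
  assumes "H \<in> sccs" "u \<in> verts H" "v \<in> verts H"
  shows "u \<rightarrow>\<^sup>* v"
  using assms in_sccs_vertsI_sccs[of "verts H"] unfolding in_sccs_verts_conv_reachable by blast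

lemma scc_mutually_reachable_closed:
  assumes "H \<in> sccs" "u \<in> verts H" "u \<rightarrow>\<^sup>* v" "v \<rightarrow>\<^sup>* u"
  shows "v \<in> verts H"
  using assms in_sccs_vertsI_sccs[of "verts H"] unfolding in_sccs_verts_conv_reachable by blast

lemma scc_eqI:
  assumes "H \<in> sccs" "H' \<in> sccs" "u \<in> verts H" "v \<in> verts H'" "u \<rightarrow>\<^sup>* v" "v \<rightarrow>\<^sup>* u"
  shows "H = H'"
proof -
  have "v \<in> verts H" using assms by (metis scc_mutually_reachable_closed)
  with assms show ?thesis using scc_disj by blast
qed

lemma ex_scc_containing:
  assumes "u \<in> verts G"
  obtains H where "H \<in> sccs" "u \<in> verts H"
proof -
  have "scc_of u \<in> verts ` sccs"
    using scc_of_in_sccs_verts[OF assms] by (simp add: sccs_verts_conv)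
  then show thesis using that in_scc_of_self[OF assms] by force
qed

lemma globally_reachable_scc_unique:
  assumes "globally_reachable_scc G H" "globally_reachable_scc G H'"
  shows "H = H'"
proof -
  have sccs: "H \<in> sccs" "H' \<in> sccs"
    using assms by (auto simp: globally_reachable_scc_def)
  obtain u where u: "u \<in> verts H" using scc_nonempty[OF sccs(1)] by blast
  obtain v where v: "v \<in> verts H'" "u \<rightarrow>\<^sup>* v"
    using assms(2) u scc_verts_subset[OF sccs(1)] by (auto simp: globally_reachable_scc_def)
  obtain w where w: "w \<in> verts H" "v \<rightarrow>\<^sup>* w"
    using assms(1) v scc_verts_subset[OF sccs(2)] by (auto simp: globally_reachable_scc_def)
  have "v \<rightarrow>\<^sup>* u"
    using w scc_reachable[OF sccs(1) w(1) u] reachable_trans by blast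
  with scc_eqI[OF sccs u v(1) v(2)] show ?thesis .
qed

lemma ex1_globally_reachable_scc_iff:
  "(\<exists>!H. globally_reachable_scc G H) \<longleftrightarrow> (\<exists>r. globally_reachable G r)"
proof
  assume "\<exists>!H. globally_reachable_scc G H"
  then obtain H where H: "globally_reachable_scc G H" by blast
  then have scc: "H \<in> sccs" by (simp add: globally_reachable_scc_def)
  obtain r where r: "r \<in> verts H" using scc_nonempty[OF scc] by blast
  have "u \<rightarrow>\<^sup>* r" if "u \<in> verts G" for u
  proof -
    obtain v where "v \<in> verts H" "u \<rightarrow>\<^sup>* v"
      using H \<open>u \<in> verts G\<close> by (auto simp: globally_reachable_scc_def)
    then show ?thesis using scc_reachable[OF scc _ r] reachable_trans by blast
  qed
  then show "\<exists>r. globally_reachable G r"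
    using r scc_verts_subset[OF scc] by (auto simp: globally_reachable_def)
next
  assume "\<exists>r. globally_reachable G r"
  then obtain r where r: "r \<in> verts G" "\<And>u. u \<in> verts G \<Longrightarrow> u \<rightarrow>\<^sup>* r"
    by (auto simp: globally_reachable_def)
  obtain H where "H \<in> sccs" "r \<in> verts H" using ex_scc_containing[OF r(1)] by metis
  then have "globally_reachable_scc G H" using r by (auto simp: globally_reachable_scc_def)
  then show "\<exists>!H. globally_reachable_scc G H" using globally_reachable_scc_unique by blast
qed

text \<open>
  Reachability projects to components: a link inside a component is dropped, any other link is an
  arc of the condensation.
\<close>

lemma condensation_reachable:
  assumes "u \<rightarrow>\<^sup>* v" "H1 \<in> sccs" "u \<in> verts H1" "H2 \<in> sccs" "v \<in> verts H2"
  shows "H1 \<rightarrow>\<^sup>*\<^bsub>condensation G\<^esub> H2"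
proof -
  interpret C: wf_digraph "condensation G"
    by unfold_locales (auto simp: condensation_def)
  show ?thesis
    using assms
  proof (induction arbitrary: H1 rule: converse_reachable_induct)
    case base
    then have "H1 = H2" using scc_disj by blast
    moreover have "H2 \<in> verts (condensation G)" using base by (simp add: condensation_def)
    ultimately show ?case by simp
  next
    case (step u w)
    obtain H where H: "H \<in> sccs" "w \<in> verts H"
      using ex_scc_containing[of w] adj_in_verts(2)[OF step.hyps(1)] by metis
    then have reach: "H \<rightarrow>\<^sup>*\<^bsub>condensation G\<^esub> H2" using step by blast
    show ?case
    proof (cases "H1 = H")
      case False
      then have "(H1, H) \<in> arcs (condensation G)"
        using step.prems H step.hyps(1) by (auto simp: condensation_def)
      then have "H1 \<rightarrow>\<^bsub>condensation G\<^esub> H"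
        using C.in_arcs_imp_in_arcs_ends by (force simp: condensation_def)
      then show ?thesis using reach C.adj_reachable_trans by blast
    qed (use reach in simp)
  qed
qed

end

context fin_digraph begin

lemma finite_sccs: "finite sccs"
  using finite_sccs_verts finite_imageD[OF _ inj_on_verts_sccs] by (simp add: sccs_verts_conv)

text \<open>
  An arc of the condensation leaving \<open>H\<close> comes from an arc of \<open>G\<close> leaving \<open>H\<close>, and a set that no
  arc leaves is left by no path.
  Finiteness is needed because the out-degree is a cardinality, which is \<open>0\<close> for infinite sets.
\<close>

lemma sink_condensation_iff:
  "sink (condensation G) H \<longleftrightarrow> H \<in> sccs \<and> (\<forall>u\<in>verts H. \<forall>v. u \<rightarrow>\<^sup>* v \<longrightarrow> v \<in> verts H)"
proof -
  have "out_arcs (condensation G) H \<subseteq> sccs \<times> sccs"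
    by (auto simp: condensation_def)
  then have "finite (out_arcs (condensation G) H)"
    using finite_sccs finite_subset by blast
  then have *: "sink (condensation G) H \<longleftrightarrow> H \<in> sccs \<and> out_arcs (condensation G) H = {}"
    by (auto simp: sink_def out_degree_def condensation_def)
  have arc: "out_arcs (condensation G) H = {} \<longleftrightarrow> (\<forall>u\<in>verts H. \<forall>v. u \<rightarrow>\<^bsub>G\<^esub> v \<longrightarrow> v \<in> verts H)"
    if scc: "H \<in> sccs"
  proof
    assume empty: "out_arcs (condensation G) H = {}"
    show "\<forall>u\<in>verts H. \<forall>v. u \<rightarrow>\<^bsub>G\<^esub> v \<longrightarrow> v \<in> verts H"
    proof (intro ballI allI impI)
      fix u v assume uv: "u \<in> verts H" "u \<rightarrow>\<^bsub>G\<^esub> v"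
      obtain H' where H': "H' \<in> sccs" "v \<in> verts H'"
        using ex_scc_containing[of v] adj_in_verts(2)[OF uv(2)] by metis
      have "(H, H') \<notin> out_arcs (condensation G) H" using empty by blast
      then have "H = H'" using scc H' uv by (auto simp: condensation_def)
      then show "v \<in> verts H" using H' by simp
    qed
  next
    assume closed: "\<forall>u\<in>verts H. \<forall>v. u \<rightarrow>\<^bsub>G\<^esub> v \<longrightarrow> v \<in> verts H"
    show "out_arcs (condensation G) H = {}"
    proof (rule equals0I)
      fix e assume "e \<in> out_arcs (condensation G) H"
      then obtain H' u v where "H' \<in> sccs" "H \<noteq> H'" "u \<in> verts H" "v \<in> verts H'" "u \<rightarrow>\<^bsub>G\<^esub> v"
        by (auto simp: condensation_def)
      with closed scc show False using scc_disj by blast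
    qed
  qed
  have path: "v \<in> verts H"
    if "\<forall>u\<in>verts H. \<forall>v. u \<rightarrow>\<^bsub>G\<^esub> v \<longrightarrow> v \<in> verts H" and "u \<in> verts H" and "u \<rightarrow>\<^sup>* v" for u v
    using that(3,1,2) by (induction rule: reachable_induct) auto
  show ?thesis using * arc path by blast
qed

text \<open>
  Among the vertices that \<open>u\<close> reaches, pick \<open>v\<close> with the fewest descendants. Each descendant of \<open>v\<close>
  has no fewer descendants, hence the same ones, and so leads back to \<open>v\<close>: no path leaves the
  component of \<open>v\<close>.
\<close>

lemma reaches_sink_component:
  assumes "u \<in> verts G"
  obtains H v where "sink (condensation G) H" "v \<in> verts H" "u \<rightarrow>\<^sup>* v"
proof -
  define R where "R = (\<lambda>v. {w. v \<rightarrow>\<^sup>* w})"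
  have fin: "finite (R v)" for v
    unfolding R_def by (rule finite_subset[OF _ finite_verts]) (auto intro: reachable_in_verts)
  obtain v where v: "u \<rightarrow>\<^sup>* v" and least: "\<And>w. u \<rightarrow>\<^sup>* w \<Longrightarrow> card (R v) \<le> card (R w)"
    using ex_has_least_nat[of "\<lambda>v. u \<rightarrow>\<^sup>* v" u "\<lambda>v. card (R v)"] assms by auto
  have returns: "w \<rightarrow>\<^sup>* v" if "v \<rightarrow>\<^sup>* w" for w
  proof -
    have "R w \<subseteq> R v" using that reachable_trans by (auto simp: R_def)
    moreover have "card (R v) \<le> card (R w)" using least v that reachable_trans by blast
    ultimately have "R w = R v" using fin card_seteq by metis
    moreover have "v \<in> R v" using v reachable_in_verts by (auto simp: R_def)
    ultimately show ?thesis by (auto simp: R_def)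
  qed
  obtain H where H: "H \<in> sccs" "v \<in> verts H"
    using ex_scc_containing[of v] v reachable_in_verts by metis
  have "x \<in> verts H" if "w \<in> verts H" "w \<rightarrow>\<^sup>* x" for w x
  proof -
    have "v \<rightarrow>\<^sup>* x" using that H scc_reachable reachable_trans by blast
    then show ?thesis using returns H scc_mutually_reachable_closed by blast
  qed
  then have "sink (condensation G) H" using H by (simp add: sink_condensation_iff)
  then show thesis using that H(2) v by blast
qed

text \<open>
  From left to right, every vertex reaches some sink, hence the only one. Conversely, a globally
  reachable vertex lies in every sink, because paths cannot leave a sink, and distinct components are
  disjoint.
\<close>

lemma ex1_sink_condensation_iff:
  "(\<exists>!H. sink (condensation G) H) \<longleftrightarrow> (\<exists>r. globally_reachable G r)"
proof
  assume unique: "\<exists>!H. sink (condensation G) H"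
  then obtain H where H: "sink (condensation G) H" by blast
  then have scc: "H \<in> sccs" by (simp add: sink_condensation_iff)
  have "\<exists>v\<in>verts H. u \<rightarrow>\<^sup>* v" if "u \<in> verts G" for u
    using reaches_sink_component[OF that] unique H by metis
  then have "globally_reachable_scc G H" using scc by (simp add: globally_reachable_scc_def)
  then show "\<exists>r. globally_reachable G r"
    using ex1_globally_reachable_scc_iff globally_reachable_scc_unique by blast
next
  assume "\<exists>r. globally_reachable G r"
  then obtain r where r: "r \<in> verts G" "\<And>u. u \<in> verts G \<Longrightarrow> u \<rightarrow>\<^sup>* r"
    by (auto simp: globally_reachable_def)
  have r_in_sink: "r \<in> verts H" if "sink (condensation G) H" for H
  proof -
    have H: "H \<in> sccs" "\<And>u v. u \<in> verts H \<Longrightarrow> u \<rightarrow>\<^sup>* v \<Longrightarrow> v \<in> verts H"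
      using that by (auto simp: sink_condensation_iff)
    obtain h where "h \<in> verts H" using scc_nonempty[OF H(1)] by blast
    then show ?thesis using H r(2) scc_verts_subset by blast
  qed
  obtain H where "sink (condensation G) H" using reaches_sink_component[OF r(1)] by metis
  moreover have "H' = H''"
    if "sink (condensation G) H'" "sink (condensation G) H''" for H' H''
    using that r_in_sink scc_disj by (metis disjoint_iff sink_condensation_iff)
  ultimately show "\<exists>!H. sink (condensation G) H" by blast
qed

lemma unique_sink_globally_reachable:
  assumes unique: "\<exists>!H. sink (condensation G) H" and H: "sink (condensation G) H"
  shows "globally_reachable (condensation G) H"
proof -
  have scc: "H \<in> sccs" using H by (simp add: sink_condensation_iff)
  have "H' \<rightarrow>\<^sup>*\<^bsub>condensation G\<^esub> H" if H': "H' \<in> sccs" for H'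
  proof -
    obtain u where u: "u \<in> verts H'" using scc_nonempty[OF H'] by blast
    then obtain v where "v \<in> verts H" "u \<rightarrow>\<^sup>* v"
      using reaches_sink_component[of u] scc_verts_subset[OF H'] unique H by (metis subsetD)
    then show ?thesis using condensation_reachable[of u v] H' u scc by blast
  qed
  then show ?thesis using scc by (auto simp: globally_reachable_def condensation_def)
qed

text \<open>
  A vertex \<open>r\<close> of a sink component works: a common descendant of \<open>r\<close> and \<open>v\<close> cannot lie outside
  the component of \<open>r\<close>, so \<open>v\<close> reaches \<open>r\<close> through it.
\<close>

lemma globally_reachable_if_common_descendants:
  assumes "verts G \<noteq> {}"
    and common: "\<And>u v. u \<in> verts G \<Longrightarrow> v \<in> verts G \<Longrightarrow> \<exists>w. u \<rightarrow>\<^sup>* w \<and> v \<rightarrow>\<^sup>* w"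
  shows "\<exists>r. globally_reachable G r"
proof -
  obtain u where "u \<in> verts G" using assms(1) by blast
  then obtain H r where H: "sink (condensation G) H" and r: "r \<in> verts H"
    using reaches_sink_component by metis
  have scc: "H \<in> sccs" and closed: "\<And>v. r \<rightarrow>\<^sup>* v \<Longrightarrow> v \<in> verts H"
    using H r by (auto simp: sink_condensation_iff)
  have rG: "r \<in> verts G" using r scc_verts_subset[OF scc] by blast
  have "v \<rightarrow>\<^sup>* r" if v: "v \<in> verts G" for v
  proof -
    obtain w where "v \<rightarrow>\<^sup>* w" "r \<rightarrow>\<^sup>* w" using common[OF v rG] by blast
    then show ?thesis using closed scc_reachable[OF scc _ r] reachable_trans by blast
  qed
  then show ?thesis using rG by (auto simp: globally_reachable_def)
qed

end

section \<open>The equivalences\<close>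

lemma fin_digraph_influence: "fin_digraph (influence_digraph W)"
  by unfold_locales (auto simp: influence_digraph_def)

lemma reachable_influence_iff:
  "u \<rightarrow>\<^sup>*\<^bsub>influence_digraph W\<^esub> v \<longleftrightarrow> (u, v) \<in> {(i, j). 0 < W $ i $ j}\<^sup>*"
proof -
  interpret fin_digraph "influence_digraph W" by (rule fin_digraph_influence)
  have "arcs_ends (influence_digraph W) = {(i, j). 0 < W $ i $ j}"
    by (force simp: arcs_ends_conv influence_digraph_def)
  moreover have "verts (influence_digraph W) = UNIV"
    by (simp add: influence_digraph_def)
  ultimately show ?thesis by (simp add: reachable_conv)
qed

theorem theorem3:
  fixes W :: "real^'n^'n" and \<alpha> \<beta> :: real
  assumes "row_stochastic W"
    and "0 < \<beta>" and "\<beta> < 1"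
    and "1 < \<alpha>"
  shows "((\<forall>x0. \<exists>xs. consensus_equilibrium \<alpha> \<beta> W xs \<and> opinions \<alpha> \<beta> W x0 \<longlonglongrightarrow> xs)
            \<longleftrightarrow> (\<exists>!H. globally_reachable_scc (influence_digraph W) H))
       \<and> ((\<exists>!H. globally_reachable_scc (influence_digraph W) H)
            \<longleftrightarrow> (\<exists>!H. sink (condensation (influence_digraph W)) H))
       \<and> ((\<exists>!H. sink (condensation (influence_digraph W)) H)
            \<longrightarrow> (\<forall>H. sink (condensation (influence_digraph W)) H
                     \<longrightarrow> globally_reachable (condensation (influence_digraph W)) H))"
proof -
  interpret best_response_dynamics W \<alpha> \<beta> by unfold_locales (use assms in auto)
  interpret G: fin_digraph "influence_digraph W" by (rule fin_digraph_influence)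
  have verts: "verts (influence_digraph W) = UNIV" by (simp add: influence_digraph_def)
  let ?reach = "\<exists>r. globally_reachable (influence_digraph W) r"
  have "opinions \<alpha> \<beta> W x = (\<lambda>k. (step ^^ k) x)" for x
    using opinions_eq_funpow by blast
  then have limit: "(\<exists>xs. consensus_equilibrium \<alpha> \<beta> W xs \<and> opinions \<alpha> \<beta> W x \<longlonglongrightarrow> xs)
      \<longleftrightarrow> (\<exists>c. (\<lambda>k. (step ^^ k) x) \<longlonglongrightarrow> c *\<^sub>R 1)" for x
    by (auto simp: consensus_equilibrium_iff)
  have "(\<forall>x. \<exists>c. (\<lambda>k. (step ^^ k) x) \<longlonglongrightarrow> c *\<^sub>R 1) \<longleftrightarrow> ?reach"
  proof
    assume "\<forall>x. \<exists>c. (\<lambda>k. (step ^^ k) x) \<longlonglongrightarrow> c *\<^sub>R 1"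
    then show ?reach
      using common_descendant_if_consensus
      by (intro G.globally_reachable_if_common_descendants) (simp_all add: verts reachable_influence_iff)
  next
    assume ?reach
    then show "\<forall>x. \<exists>c. (\<lambda>k. (step ^^ k) x) \<longlonglongrightarrow> c *\<^sub>R 1"
      using converges_to_consensus by (auto simp: globally_reachable_def verts reachable_influence_iff)
  qed
  then show ?thesis
    using G.ex1_globally_reachable_scc_iff G.ex1_sink_condensation_iff
      G.unique_sink_globally_reachable limit by simp
qed

end
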